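(* Let $p(x,\theta)=e^{\theta\cdot T(x)-\psi(\theta)}$ be a minimal $n$-dimensional exponential family and fix an observed datum $y$. The $n$-dimensional conditional exponential family $d\mathbb P^{x|y}_\theta=k(\cdot|y,\theta)d\mu_y$, $\theta\in\Theta$, has an equivalent minimal representation as an $m$-dimensional exponential family $d\mathbb P^{x|y}_{\theta'}=\bar k(\cdot|y,\theta')d\mu_y$, where $\theta'=P\theta$ for an orthogonal projection $P$ onto an $m$-dimensional subspace $V$ of $\mathbb R^n$. That is, with $T'=P\circ T$, $\bar\psi_y(\theta')=\log\int_{h^{-1}(y)}e^{\theta'\cdot T'(x)}d\mu_y(x)$ and $\bar k(x|y,\theta')=e^{\theta'\cdot T'(x)-\bar\psi_y(\theta')}$, one has $\mathbb P^{x|y}_\theta=\mathbb P^{x|y}_{\theta'}$ for all $\theta\in\Theta$, $\theta'=P\theta$, and the sufficient statistic $T'$ is minimal (there is no $0\ne v\in V$ such that $v\cdot T'(x)$ is constant for $\mu_y$-a.a. $x\in h^{-1}(y)$). Under this reduction the Kullback-Leibler divergences are related by $K_y(\theta||\theta^+)=\bar K_y(\theta'||\theta'^+)$ with $\theta'=P\theta$, $\theta'^+=P\theta^+$.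
   Context: $X$ is a measurable space with $\sigma$-finite measure $\mu$; $h:X\to Y$ measurable, $\nu=\mu\circ h^{-1}$, $(\mu_y)_{y\in Y}$ a disintegration of $\mu$ with respect to $\nu$: each $\mu_y$ is concentrated on $h^{-1}(y)$ and $\int_Xf\,d\mu=\int_Y\int_{h^{-1}(y)}f\,d\mu_y\,d\nu(y)$. $T:X\to\mathbb R^n$ is measurable, $\psi(\theta)=\log\int_Xe^{\theta\cdot T}d\mu$, $\Theta=\{\theta\in\mathbb R^n:\int_Xe^{\theta\cdot T}d\mu<\infty\}$ is assumed of full dimension $n$. Minimality of $p$: no $a\ne0$ makes $a\cdot T(x)$ constant $\mu$-a.e. The incomplete data density is $q(y,\theta)=\int_{h^{-1}(y)}p(x,\theta)d\mu_y(x)$ (positive and finite for $\theta\in\Theta$), and the conditional density is $k(x|y,\theta)=p(x,\theta)/q(y,\theta)=e^{\theta\cdot T(x)-\psi_y(\theta)}$, $\psi_y(\theta)=\log\int_{h^{-1}(y)}e^{\theta\cdot T}d\mu_y$. The Kullback-Leibler divergences are $$K_y(\theta||\theta^+)=\int_{h^{-1}(y)}k(x|y,\theta)\log\frac{k(x|y,\theta)}{k(x|y,\theta^+)}d\mu_y(x),\quad \bar K_y(\theta'||\theta'^+)=\int_{h^{-1}(y)}\bar k(x|y,\theta')\log\frac{\bar k(x|y,\theta')}{\bar k(x|y,\theta'^+)}d\mu_y(x).$$ *)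

theory Defs
  imports "HOL-Analysis.Analysis"
begin

(* The fibre integral over h -` {y} is written as an integral over the whole space against
   \<kappa> y; by the concentration condition the two coincide. Singletons of Y need not be measurable. *)
definition disintegration ::
  "'x measure \<Rightarrow> 'y measure \<Rightarrow> ('x \<Rightarrow> 'y) \<Rightarrow> ('y \<Rightarrow> 'x measure) \<Rightarrow> bool" where
  "disintegration X Y h \<kappa> \<longleftrightarrow>
     (\<forall>y\<in>space Y. sets (\<kappa> y) = sets X) \<and>
     (\<forall>y\<in>space Y. AE x in \<kappa> y. h x = y) \<and>
     (\<forall>f::'x \<Rightarrow> ennreal. f \<in> borel_measurable X \<longrightarrow>
        (\<lambda>y. \<integral>\<^sup>+x. f x \<partial>\<kappa> y) \<in> borel_measurable Y \<and>
        (\<integral>\<^sup>+x. f x \<partial>X) = (\<integral>\<^sup>+y. (\<integral>\<^sup>+x. f x \<partial>\<kappa> y) \<partial>distr X Y h))"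

definition natural_params :: "'x measure \<Rightarrow> ('x \<Rightarrow> 'e::euclidean_space) \<Rightarrow> 'e set" where
  "natural_params B S = {\<theta>. (\<integral>\<^sup>+x. ennreal (exp (\<theta> \<bullet> S x)) \<partial>B) < \<infinity>}"

definition log_partition :: "'x measure \<Rightarrow> ('x \<Rightarrow> 'e::euclidean_space) \<Rightarrow> 'e \<Rightarrow> real" where
  "log_partition B S \<theta> = ln (\<integral>x. exp (\<theta> \<bullet> S x) \<partial>B)"

definition exp_density :: "'x measure \<Rightarrow> ('x \<Rightarrow> 'e::euclidean_space) \<Rightarrow> 'e \<Rightarrow> 'x \<Rightarrow> real" where
  "exp_density B S \<theta> x = exp (\<theta> \<bullet> S x - log_partition B S \<theta>)"

definition minimal_statistic ::
  "'x measure \<Rightarrow> 'e::euclidean_space set \<Rightarrow> ('x \<Rightarrow> 'e) \<Rightarrow> bool" where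
  "minimal_statistic B V S \<longleftrightarrow> \<not> (\<exists>v\<in>V. v \<noteq> 0 \<and> (\<exists>c. AE x in B. v \<bullet> S x = c))"

(* V plays the role of the ambient Euclidean space, so the dimension of the family is dim V. *)
definition minimal_exp_family ::
  "'x measure \<Rightarrow> 'e::euclidean_space set \<Rightarrow> ('x \<Rightarrow> 'e) \<Rightarrow> 'e set \<Rightarrow> bool" where
  "minimal_exp_family B V S \<Xi> \<longleftrightarrow>
     S \<in> borel_measurable B \<and> (\<forall>x\<in>space B. S x \<in> V) \<and>
     \<Xi> \<subseteq> V \<inter> natural_params B S \<and> aff_dim \<Xi> = int (dim V) \<and>
     minimal_statistic B V S"

definition incomplete_density ::
  "'x measure \<Rightarrow> ('y \<Rightarrow> 'x measure) \<Rightarrow> ('x \<Rightarrow> 'e::euclidean_space) \<Rightarrow> 'y \<Rightarrow> 'e \<Rightarrow> real" where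
  "incomplete_density X \<kappa> T y \<theta> = (\<integral>x. exp_density X T \<theta> x \<partial>\<kappa> y)"

definition cond_density ::
  "'x measure \<Rightarrow> ('y \<Rightarrow> 'x measure) \<Rightarrow> ('x \<Rightarrow> 'e::euclidean_space) \<Rightarrow> 'y \<Rightarrow> 'e \<Rightarrow> 'x \<Rightarrow> real" where
  "cond_density X \<kappa> T y \<theta> x = exp_density X T \<theta> x / incomplete_density X \<kappa> T y \<theta>"

definition orthogonal_projection_onto :: "'e::euclidean_space set \<Rightarrow> ('e \<Rightarrow> 'e) \<Rightarrow> bool" where
  "orthogonal_projection_onto V P \<longleftrightarrow>
     linear P \<and> range P = V \<and> (\<forall>x. \<forall>v\<in>V. orthogonal (x - P x) v)"

(* Positive minus negative part, so that an infinite divergence has value \<infinity> instead of the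
   Bochner integral's default 0. For probability densities k, k' the negative part is finite. *)
definition KL_densities :: "'x measure \<Rightarrow> ('x \<Rightarrow> real) \<Rightarrow> ('x \<Rightarrow> real) \<Rightarrow> ereal" where
  "KL_densities B k k' =
     enn2ereal (\<integral>\<^sup>+x. ennreal (k x * ln (k x / k' x)) \<partial>B) -
     enn2ereal (\<integral>\<^sup>+x. ennreal (- (k x * ln (k x / k' x))) \<partial>B)"

end

(* Let W be the space of all directions a for which a . T is a.e. constant on the fibre, and let P
   be the orthogonal projection onto the orthogonal complement V of W. Since \<theta> - P \<theta> lies in W,
   exp (\<theta> . T) and exp (P \<theta> . T) differ a.e. by a constant factor, which normalisation removes;
   and a direction of V along which P o T is constant lies in V \<inter> W = {0}. *)
theory Submission
  imports Defs
begin

text \<open>Expansion along an orthogonal basis of \<open>V\<close>: each value lies in the span of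
  the basis, and the Gram-Schmidt residual is orthogonal to that span.\<close>

lemma orthogonal_projection_onto_exists:
  fixes V :: "'e::euclidean_space set"
  assumes "subspace V"
  shows "\<exists>P. orthogonal_projection_onto V P"
proof -
  obtain B where B: "B \<subseteq> V" "pairwise orthogonal B" "independent B" "span B = V"
    using orthonormal_basis_subspace[OF assms] by metis
  have "finite B"
    using B(3) by (rule independent_imp_finite)
  \<comment> \<open>The division by \<open>b \<bullet> b\<close> gives the sum the shape of the
    Gram-Schmidt correction; of the basis, only orthogonality is kept, not unit length.\<close>
  define P where "P = (\<lambda>x. \<Sum>b\<in>B. (b \<bullet> x / (b \<bullet> b)) *\<^sub>R b)"
  have "linear P"
    unfolding P_def
    by (auto intro!: linearI simp: inner_add_right add_divide_distrib scaleR_add_left sum.distrib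
        scaleR_sum_right)
  have in_V: "P x \<in> V" for x
    unfolding P_def B(4)[symmetric] by (intro span_sum span_scale span_base)
  have orth: "orthogonal (x - P x) v" if "v \<in> V" for x v
    using Gram_Schmidt_step[OF B(2), of v x] that B(4)
    by (simp add: P_def orthogonal_commute)
  \<comment> \<open>For \<open>v\<close> in \<open>V\<close> the residual lies in \<open>V\<close>
    and is orthogonal to \<open>V\<close>, hence to itself. So \<open>P\<close> fixes
    \<open>V\<close>, and its range is all of \<open>V\<close>.\<close>
  have "P v = v" if "v \<in> V" for v
  proof -
    have "v - P v \<in> V"
      using that in_V assms by (simp add: subspace_diff)
    from orth[OF this, of v] show ?thesis
      by (simp add: orthogonal_self)
  qed
  then have "range P = V"
    using in_V by (metis rangeI image_subset_iff subsetI subset_antisym)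
  with \<open>linear P\<close> orth show ?thesis
    unfolding orthogonal_projection_onto_def by blast
qed

text \<open>The residual \<open>x - P x\<close> is invisible to directions in \<open>V\<close>. This
  lets \<open>P \<circ> T\<close> and \<open>T\<close> be exchanged under an inner product with such
  a direction.\<close>

lemma inner_orthogonal_projection:
  assumes "orthogonal_projection_onto V P" "v \<in> V"
  shows "v \<bullet> P x = v \<bullet> x"
proof -
  have "(x - P x) \<bullet> v = 0"
    using assms unfolding orthogonal_projection_onto_def orthogonal_def by blast
  then show ?thesis
    by (simp add: inner_diff_left inner_commute[of v])
qed

text \<open>The a.e. constants add and scale together with the directions. Being a subspace is what
  lets this set be recovered from its orthogonal complement.\<close>

lemma subspace_AE_constant:
  fixes S :: "'x \<Rightarrow> 'e::euclidean_space"
  shows "subspace {a. \<exists>c. AE x in M. a \<bullet> S x = c}"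
proof (rule subspaceI)
  show "0 \<in> {a. \<exists>c. AE x in M. a \<bullet> S x = c}"
    by auto
next
  fix a b
  assume "a \<in> {a. \<exists>c. AE x in M. a \<bullet> S x = c}" "b \<in> {a. \<exists>c. AE x in M. a \<bullet> S x = c}"
  then obtain c d where "AE x in M. a \<bullet> S x = c" "AE x in M. b \<bullet> S x = d"
    by blast
  then have "AE x in M. (a + b) \<bullet> S x = c + d"
    by eventually_elim (simp add: inner_add_left)
  then show "a + b \<in> {a. \<exists>c. AE x in M. a \<bullet> S x = c}"
    by blast
next
  fix r a
  assume "a \<in> {a. \<exists>c. AE x in M. a \<bullet> S x = c}"
  then obtain c where "AE x in M. a \<bullet> S x = c"
    by blast
  then have "AE x in M. (r *\<^sub>R a) \<bullet> S x = r * c"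
    by eventually_elim simp
  then show "r *\<^sub>R a \<in> {a. \<exists>c. AE x in M. a \<bullet> S x = c}"
    by blast
qed

text \<open>Full affine dimension means that the affine hull is the whole space, and linear maps
  commute with affine hulls.\<close>

lemma aff_dim_linear_image_full:
  fixes P :: "'e::euclidean_space \<Rightarrow> 'e"
  assumes "linear P" "aff_dim \<Xi> = int (dim (UNIV :: 'e set))"
  shows "aff_dim (P ` \<Xi>) = int (dim (range P))"
proof -
  have "affine hull \<Xi> = UNIV"
    using assms(2) by (simp add: aff_dim_eq_full)
  then have "affine hull (P ` \<Xi>) = range P"
    using affine_hull_linear_image[of P \<Xi>] assms(1) by (simp add: linear_linear)
  moreover have "subspace (range P)"
    using assms(1) by (simp add: linear_subspace_image)
  ultimately show ?thesis
    by (metis aff_dim_affine_hull aff_dim_subspace)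
qed

text \<open>The additive constant \<open>c\<close> becomes a factor \<open>exp c\<close> of both the
  exponential and its integral, and cancels in the quotient.\<close>

lemma exp_density_AE_shift:
  fixes S :: "'x \<Rightarrow> 'e::euclidean_space" and S' :: "'x \<Rightarrow> 'f::euclidean_space"
  assumes meas: "S \<in> borel_measurable M"
    and shift: "AE x in M. \<theta> \<bullet> S x = \<eta> \<bullet> S' x + c"
    and meas': "S' \<in> borel_measurable M"
    and int: "integrable M (\<lambda>x. exp (\<theta> \<bullet> S x))"
    and pos: "0 < (\<integral>x. exp (\<theta> \<bullet> S x) \<partial>M)"
  shows "\<eta> \<in> natural_params M S'"
    and "AE x in M. exp (\<theta> \<bullet> S x) / (\<integral>x. exp (\<theta> \<bullet> S x) \<partial>M) = exp_density M S' \<eta> x"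
proof -
  have exp_meas: "(\<lambda>x. exp (\<theta> \<bullet> S x)) \<in> borel_measurable M"
      "(\<lambda>x. exp c * exp (\<eta> \<bullet> S' x)) \<in> borel_measurable M"
    using meas meas' by measurable
  have eq: "AE x in M. exp (\<theta> \<bullet> S x) = exp c * exp (\<eta> \<bullet> S' x)"
    using shift by eventually_elim (simp add: exp_add)
  have integrable: "integrable M (\<lambda>x. exp (\<eta> \<bullet> S' x))"
  proof -
    have "integrable M (\<lambda>x. exp c * exp (\<eta> \<bullet> S' x))"
      using int integrable_cong_AE[OF exp_meas eq] by simp
    then show ?thesis
      by simp
  qed
  then show "\<eta> \<in> natural_params M S'"
    by (simp add: natural_params_def nn_integral_eq_integral)
  have integral: "(\<integral>x. exp (\<theta> \<bullet> S x) \<partial>M) = exp c * (\<integral>x. exp (\<eta> \<bullet> S' x) \<partial>M)"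
  proof -
    have "(\<integral>x. exp (\<theta> \<bullet> S x) \<partial>M) = (\<integral>x. exp c * exp (\<eta> \<bullet> S' x) \<partial>M)"
      using exp_meas eq by (rule integral_cong_AE)
    then show ?thesis
      by simp
  qed
  \<comment> \<open>Positivity is what allows \<open>exp\<close> to undo the \<open>ln\<close>
    inside \<open>log_partition\<close>.\<close>
  then have "0 < (\<integral>x. exp (\<eta> \<bullet> S' x) \<partial>M)"
    using pos by (simp add: zero_less_mult_iff)
  with eq show "AE x in M. exp (\<theta> \<bullet> S x) / (\<integral>x. exp (\<theta> \<bullet> S x) \<partial>M) = exp_density M S' \<eta> x"
    unfolding integral exp_density_def log_partition_def
    by (auto elim!: eventually_mono simp: exp_diff)
qed

text \<open>The global normalisation \<open>exp (- log_partition X T \<theta>)\<close> does not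
  depend on \<open>x\<close>, so it cancels and only the fibre integral remains.\<close>

lemma cond_density_eq:
  "cond_density X \<kappa> T y \<theta> x = exp (\<theta> \<bullet> T x) / (\<integral>x. exp (\<theta> \<bullet> T x) \<partial>\<kappa> y)"
  by (simp add: cond_density_def incomplete_density_def exp_density_def exp_diff)

text \<open>The positive and the negative part are separate nonnegative integrals, each insensitive
  to null sets, so the equality covers infinite divergences too.\<close>

lemma KL_densities_cong_AE:
  assumes "AE x in M. k x = l x" "AE x in M. k' x = l' x"
  shows "KL_densities M k k' = KL_densities M l l'"
proof -
  have "(\<integral>\<^sup>+x. ennreal (k x * ln (k x / k' x)) \<partial>M) = (\<integral>\<^sup>+x. ennreal (l x * ln (l x / l' x)) \<partial>M)"
    by (rule nn_integral_cong_AE) (use assms in eventually_elim, simp)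
  moreover have "(\<integral>\<^sup>+x. ennreal (- (k x * ln (k x / k' x))) \<partial>M) =
      (\<integral>\<^sup>+x. ennreal (- (l x * ln (l x / l' x))) \<partial>M)"
    by (rule nn_integral_cong_AE) (use assms in eventually_elim, simp)
  ultimately show ?thesis
    by (simp add: KL_densities_def)
qed

theorem proposition3:
  fixes X :: "'x measure" and Y :: "'y measure" and h :: "'x \<Rightarrow> 'y"
    and \<kappa> :: "'y \<Rightarrow> 'x measure" and T :: "'x \<Rightarrow> real ^ 'n" and y :: 'y
  assumes "sigma_finite_measure X"
    and "h \<in> measurable X Y"
    and "disintegration X Y h \<kappa>"
    and "minimal_exp_family X UNIV T (natural_params X T)"
    and "y \<in> space Y"
    and "\<And>\<theta>. \<theta> \<in> natural_params X T \<Longrightarrow>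
           integrable (\<kappa> y) (exp_density X T \<theta>) \<and> 0 < incomplete_density X \<kappa> T y \<theta>"
  shows "\<exists>m V P. subspace V \<and> dim V = m \<and> orthogonal_projection_onto V P \<and>
           minimal_exp_family (\<kappa> y) V (P \<circ> T) (P ` natural_params X T) \<and>
           (\<forall>\<theta>\<in>natural_params X T.
              density (\<kappa> y) (\<lambda>x. ennreal (cond_density X \<kappa> T y \<theta> x)) =
              density (\<kappa> y) (\<lambda>x. ennreal (exp_density (\<kappa> y) (P \<circ> T) (P \<theta>) x))) \<and>
           (\<forall>\<theta>\<in>natural_params X T. \<forall>\<eta>\<in>natural_params X T.
              KL_densities (\<kappa> y) (cond_density X \<kappa> T y \<theta>) (cond_density X \<kappa> T y \<eta>) =
              KL_densities (\<kappa> y) (exp_density (\<kappa> y) (P \<circ> T) (P \<theta>))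
                                  (exp_density (\<kappa> y) (P \<circ> T) (P \<eta>)))"
proof -
  let ?M = "\<kappa> y" and ?N = "natural_params X T"
  have sets: "sets ?M = sets X"
    using assms(3,5) by (simp add: disintegration_def)
  have fam: "T \<in> borel_measurable X" "aff_dim ?N = int (dim (UNIV :: (real ^ 'n) set))"
    using assms(4) by (simp_all add: minimal_exp_family_def)
  have T: "T \<in> borel_measurable ?M"
    using fam(1) sets by (simp cong: measurable_cong_sets)
  define W where "W = {a. \<exists>c. AE x in ?M. a \<bullet> T x = c}"
  define V where "V = W\<^sup>\<bottom>"
  have "subspace W"
    unfolding W_def by (rule subspace_AE_constant)
  have "subspace V"
    unfolding V_def by (rule subspace_orthogonal_comp)
  then obtain P where P: "orthogonal_projection_onto V P"
    using orthogonal_projection_onto_exists by blast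
  then have lin: "linear P" and range: "range P = V"
    by (simp_all add: orthogonal_projection_onto_def)
  have PT: "P \<circ> T \<in> borel_measurable ?M"
    using T lin
    by (intro measurable_comp[of T _ borel] borel_measurable_continuous_onI linear_continuous_on)
      (simp_all add: linear_conv_bounded_linear)
  have "\<exists>c. AE x in ?M. \<theta> \<bullet> T x = P \<theta> \<bullet> (P \<circ> T) x + c" for \<theta>
  proof -
    have "\<theta> - P \<theta> \<in> V\<^sup>\<bottom>"
      using P by (auto simp: orthogonal_projection_onto_def orthogonal_comp_def orthogonal_commute)
    \<comment> \<open>In finite dimension a subspace equals its double orthogonal complement, so the
      part of \<theta> removed by \<open>P\<close> contributes only an a.e. constant.\<close>
    then have "\<theta> - P \<theta> \<in> W"
      using orthogonal_comp_self[OF \<open>subspace W\<close>] by (simp add: V_def)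
    then obtain c where "AE x in ?M. (\<theta> - P \<theta>) \<bullet> T x = c"
      by (auto simp: W_def)
    moreover have "P \<theta> \<bullet> P (T x) = P \<theta> \<bullet> T x" for x
      using P range by (intro inner_orthogonal_projection) auto
    ultimately have "AE x in ?M. \<theta> \<bullet> T x = P \<theta> \<bullet> (P \<circ> T) x + c"
      by (auto elim!: eventually_mono simp: inner_diff_left)
    then show ?thesis ..
  qed
  then obtain c where c: "\<And>\<theta>. AE x in ?M. \<theta> \<bullet> T x = P \<theta> \<bullet> (P \<circ> T) x + c \<theta>"
    by metis
  \<comment> \<open>Multiplying by the constant \<open>exp (log_partition X T \<theta>)\<close>
    turns the assumptions on the incomplete density into statements about the unnormalised
    exponential.\<close>
  have int: "integrable ?M (\<lambda>x. exp (\<theta> \<bullet> T x))" and pos: "0 < (\<integral>x. exp (\<theta> \<bullet> T x) \<partial>?M)"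
    if "\<theta> \<in> ?N" for \<theta>
    using assms(6)[OF that]
      integrable_mult_left[of "exp (log_partition X T \<theta>)" ?M "exp_density X T \<theta>"]
    by (simp_all add: exp_density_def[abs_def] incomplete_density_def exp_diff zero_less_divide_iff)
  have natural: "P \<theta> \<in> natural_params ?M (P \<circ> T)"
    and cond: "AE x in ?M. cond_density X \<kappa> T y \<theta> x = exp_density ?M (P \<circ> T) (P \<theta>) x"
    if "\<theta> \<in> ?N" for \<theta>
    using exp_density_AE_shift[OF T c PT int[OF that] pos[OF that]]
    by (simp_all add: cond_density_eq)
  have minimal: "minimal_statistic ?M V (P \<circ> T)"
    unfolding minimal_statistic_def
  proof clarify
    fix v c
    assume "v \<in> V" "v \<noteq> 0" "AE x in ?M. v \<bullet> (P \<circ> T) x = c"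
    \<comment> \<open>Since \<open>v\<close> lies in \<open>V\<close>,
      \<open>v \<bullet> P (T x)\<close> equals \<open>v \<bullet> T x\<close>, so \<open>v\<close>
      is also a direction of constancy of \<open>T\<close> and therefore orthogonal to
      itself.\<close>
    then have "v \<in> W"
      using inner_orthogonal_projection[OF P] by (auto simp: W_def)
    with \<open>v \<in> V\<close> have "orthogonal v v"
      by (auto simp: V_def orthogonal_comp_def)
    with \<open>v \<noteq> 0\<close> show False
      by (simp add: orthogonal_self)
  qed
  \<comment> \<open>The parameter set is the image of \<open>?N\<close>, which lies in the natural
    parameter set of the fibre; its full dimension in \<open>V\<close> is inherited from that of
    \<open>?N\<close>.\<close>
  have family: "minimal_exp_family ?M V (P \<circ> T) (P ` ?N)"
    using PT range natural minimal aff_dim_linear_image_full[OF lin fam(2)]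
    by (auto simp: minimal_exp_family_def)
  have dens: "density ?M (\<lambda>x. ennreal (cond_density X \<kappa> T y \<theta> x)) =
      density ?M (\<lambda>x. ennreal (exp_density ?M (P \<circ> T) (P \<theta>) x))" if "\<theta> \<in> ?N" for \<theta>
  proof (rule density_cong)
    show "(\<lambda>x. ennreal (cond_density X \<kappa> T y \<theta> x)) \<in> borel_measurable ?M"
      using T unfolding cond_density_eq by measurable
    show "(\<lambda>x. ennreal (exp_density ?M (P \<circ> T) (P \<theta>) x)) \<in> borel_measurable ?M"
      using PT unfolding exp_density_def by measurable
    show "AE x in ?M. ennreal (cond_density X \<kappa> T y \<theta> x) =
        ennreal (exp_density ?M (P \<circ> T) (P \<theta>) x)"
      using cond[OF that] by eventually_elim simp
  qed
  show ?thesis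
    using \<open>subspace V\<close> P family dens KL_densities_cong_AE[OF cond cond] by blast
qed

end
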